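(* There is a HyperCTL formula $\varphi_{NI}(G_H,G_L)$ (for groups of users $G_H,G_L$) and an encoding $M\mapsto K(M)$ of deterministic state machines into Kripke structures such that for every deterministic state machine $M$ and all groups of users $G_H,G_L\subseteq U$: $G_H$ does not interfere with $G_L$ in $M$ if and only if $K(M)\models\varphi_{NI}(G_H,G_L)$.
   Context: A deterministic state machine is $M=(S,U,C,V_O,\mathsf{out},\mathsf{do},s_0)$ with states $S$, users $U$, commands $C$, observations $V_O$, transition function $\mathsf{do}:S\times U\times C\to S$, observation function $\mathsf{out}:S\times U\to V_O$ and initial state $s_0$. $\mathsf{do}$ is extended to sequences $w\in(U\times C)^*$ by $\mathsf{do}(s,(u,c).w)=\mathsf{do}(\mathsf{do}(s,u,c),w)$, and for a group $G\subseteq U$ let $\mathsf{out}(w,G)$ denote the observations of the users in $G$ in state $\mathsf{do}(s_0,w)$. For $w\in(U\times C)^*$ let $\mathrm{purge}_{G_H}(w)$ be $w$ with all pairs $(u,c)$ with $u\in G_H$ removed. $G_H$ does not interfere with $G_L$ in $M$ iff for all $w\in(U\times C)^*$, $\mathsf{out}(w,G_L)=\mathsf{out}(\mathrm{purge}_{G_H}(w),G_L)$. Kripke structures and HyperCTL: a Kripke structure $(S,s_0,\delta,\mathsf{AP},L)$ has $\delta:S\to2^S$, $\delta(s)\ne\emptyset$, $L:S\to2^{\mathsf{AP}}$; paths are infinite state sequences following $\delta$ with their label sets $\pi[i]$. HyperCTL: $\varphi ::= a_\pi\mid\neg\varphi\mid\varphi\vee\varphi\mid\mathsf X\varphi\mid\varphi\,\mathcal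 U\,\varphi\mid\exists\pi.\varphi$, evaluated on tuples of paths $\Pi=\langle\pi_1,\dots,\pi_n\rangle$: $a_{\pi_k}$ iff $a\in\pi_k[0]$, $\mathsf X$ and $\mathcal U$ shift all paths synchronously, $\exists\pi.\psi$ iff some path $\pi$ from the current state of $\pi_n$ (from $s_0$ if $\Pi$ is empty) gives $\langle\pi_1,\dots,\pi_n,\pi\rangle\models\psi$; $K\models\varphi$ iff $\langle\rangle\models_K\varphi$. *)

theory Defs
  imports Main "HOL-Library.FuncSet"
begin

section \<open>Deterministic state machines and noninterference\<close>

record ('s, 'u, 'c, 'o) machine =
  mstates :: "'s set"
  users :: "'u set"
  commands :: "'c set"
  observations :: "'o set"
  out :: "'s \<Rightarrow> 'u \<Rightarrow> 'o"
  step :: "'s \<Rightarrow> 'u \<Rightarrow> 'c \<Rightarrow> 's"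
  minit :: 's

definition machine :: "('s, 'u, 'c, 'o) machine \<Rightarrow> bool" where
  "machine M \<longleftrightarrow>
     minit M \<in> mstates M \<and>
     (\<forall>s \<in> mstates M. \<forall>u \<in> users M. \<forall>c \<in> commands M. step M s u c \<in> mstates M) \<and>
     (\<forall>s \<in> mstates M. \<forall>u \<in> users M. out M s u \<in> observations M)"

fun run :: "('s, 'u, 'c, 'o) machine \<Rightarrow> 's \<Rightarrow> ('u \<times> 'c) list \<Rightarrow> 's" where
  "run M s [] = s"
| "run M s ((u, c) # w) = run M (step M s u c) w"

definition outs :: "('s, 'u, 'c, 'o) machine \<Rightarrow> ('u \<times> 'c) list \<Rightarrow> 'u set \<Rightarrow> 'u \<Rightarrow> 'o" where
  "outs M w G = restrict (out M (run M (minit M) w)) G"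

definition purge :: "'u set \<Rightarrow> ('u \<times> 'c) list \<Rightarrow> ('u \<times> 'c) list" where
  "purge G w = filter (\<lambda>(u, c). u \<notin> G) w"

definition not_interferes :: "('s, 'u, 'c, 'o) machine \<Rightarrow> 'u set \<Rightarrow> 'u set \<Rightarrow> bool" where
  "not_interferes M GH GL \<longleftrightarrow>
     (\<forall>w \<in> lists (users M \<times> commands M). outs M w GL = outs M (purge GH w) GL)"


section \<open>Kripke structures and HyperCTL\<close>

record ('k, 'a) kripke =
  kstates :: "'k set"
  kinit :: 'k
  succs :: "'k \<Rightarrow> 'k set"
  props :: "'a set"
  label :: "'k \<Rightarrow> 'a set"

definition kripke :: "('k, 'a) kripke \<Rightarrow> bool" where
  "kripke K \<longleftrightarrow>
     kinit K \<in> kstates K \<and>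
     (\<forall>s \<in> kstates K. succs K s \<subseteq> kstates K \<and> succs K s \<noteq> {} \<and> label K s \<subseteq> props K)"

definition is_path :: "('k, 'a) kripke \<Rightarrow> (nat \<Rightarrow> 'k) \<Rightarrow> bool" where
  "is_path K p \<longleftrightarrow> (\<forall>i. p i \<in> kstates K \<and> p (Suc i) \<in> succs K (p i))"

text \<open>Path variables are positions in the tuple of paths, counted from 0: \<open>Atom a k\<close> refers to
  the path bound by the quantifier at nesting depth \<open>k\<close>.\<close>

datatype 'a hyperctl =
    Atom 'a nat
  | Neg "'a hyperctl"
  | Disj "'a hyperctl" "'a hyperctl"
  | Next "'a hyperctl"
  | Until "'a hyperctl" "'a hyperctl"
  | Ex_path "'a hyperctl"

text \<open>\<open>formula_over A n \<phi>\<close>: the propositions of \<open>\<phi>\<close> lie in \<open>A\<close> and its free path variables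
  are among the first \<open>n\<close>.\<close>

primrec formula_over :: "'a set \<Rightarrow> nat \<Rightarrow> 'a hyperctl \<Rightarrow> bool" where
  "formula_over A n (Atom a k) \<longleftrightarrow> a \<in> A \<and> k < n"
| "formula_over A n (Neg \<phi>) \<longleftrightarrow> formula_over A n \<phi>"
| "formula_over A n (Disj \<phi> \<psi>) \<longleftrightarrow> formula_over A n \<phi> \<and> formula_over A n \<psi>"
| "formula_over A n (Next \<phi>) \<longleftrightarrow> formula_over A n \<phi>"
| "formula_over A n (Until \<phi> \<psi>) \<longleftrightarrow> formula_over A n \<phi> \<and> formula_over A n \<psi>"
| "formula_over A n (Ex_path \<phi>) \<longleftrightarrow> formula_over A (Suc n) \<phi>"

definition shift :: "nat \<Rightarrow> (nat \<Rightarrow> 'k) list \<Rightarrow> (nat \<Rightarrow> 'k) list" where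
  "shift i ps = map (\<lambda>p j. p (i + j)) ps"

primrec sat :: "('k, 'a) kripke \<Rightarrow> (nat \<Rightarrow> 'k) list \<Rightarrow> 'a hyperctl \<Rightarrow> bool" where
  "sat K ps (Atom a k) \<longleftrightarrow> a \<in> label K ((ps ! k) 0)"
| "sat K ps (Neg \<phi>) \<longleftrightarrow> \<not> sat K ps \<phi>"
| "sat K ps (Disj \<phi> \<psi>) \<longleftrightarrow> sat K ps \<phi> \<or> sat K ps \<psi>"
| "sat K ps (Next \<phi>) \<longleftrightarrow> sat K (shift 1 ps) \<phi>"
| "sat K ps (Until \<phi> \<psi>) \<longleftrightarrow>
     (\<exists>i. sat K (shift i ps) \<psi> \<and> (\<forall>j<i. sat K (shift j ps) \<phi>))"
| "sat K ps (Ex_path \<phi>) \<longleftrightarrow>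
     (\<exists>p. is_path K p \<and> p 0 = (if ps = [] then kinit K else last ps 0) \<and> sat K (ps @ [p]) \<phi>)"

definition models :: "('k, 'a) kripke \<Rightarrow> 'a hyperctl \<Rightarrow> bool" where
  "models K \<phi> \<longleftrightarrow> sat K [] \<phi>"


section \<open>Encodings of state machines\<close>

text \<open>Without any restriction, ``there is an encoding'' could be met by a structure whose
  labels simply list the pairs of groups that do not interfere. An encoding is therefore required
  to execute the machine: a state of the structure consists of the current states of a fixed
  number \<open>n\<close> of copies of the machine, each together with the input that led to it
  (\<open>None\<close> at the start and after idling), and its label depends only on the
  inputs and on the users' current observations.\<close>

type_synonym ('u, 'c, 'o) snapshot = "(('u \<times> 'c) option \<times> ('u \<Rightarrow> 'o)) list"

type_synonym ('s, 'u, 'c) config = "('s \<times> ('u \<times> 'c) option) list"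

definition snapshot ::
    "('s, 'u, 'c, 'o) machine \<Rightarrow> ('s, 'u, 'c) config \<Rightarrow> ('u, 'c, 'o) snapshot" where
  "snapshot M x = map (\<lambda>(s, a). (a, restrict (out M s) (users M))) x"

definition moves ::
    "('s, 'u, 'c, 'o) machine \<Rightarrow> 's \<Rightarrow> ('s \<times> ('u \<times> 'c) option) set" where
  "moves M s = insert (s, None)
     {(step M s u c, Some (u, c)) | u c. u \<in> users M \<and> c \<in> commands M}"

text \<open>The atomic propositions are all predicates on snapshots, represented as sets. Every other
  labelling by a function of the snapshot (for instance by the inputs \<open>(u, c)\<close> and the
  observations \<open>(u, v)\<close>) consists of such predicates.\<close>

definition copies ::
    "nat \<Rightarrow> ('s, 'u, 'c, 'o) machine \<Rightarrow>
      (('s, 'u, 'c) config, ('u, 'c, 'o) snapshot set) kripke" where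
  "copies n M =
     \<lparr> kstates = {x. length x = n \<and>
          set x \<subseteq> mstates M \<times> insert None (Some ` (users M \<times> commands M))},
       kinit = replicate n (minit M, None),
       succs = (\<lambda>x. {y. list_all2 (\<lambda>sa tb. tb \<in> moves M (fst sa)) x y}),
       props = UNIV,
       label = (\<lambda>x. {P. snapshot M x \<in> P}) \<rparr>"

definition is_encoding ::
    "(('s, 'u, 'c, 'o) machine \<Rightarrow>
      (('s, 'u, 'c) config, ('u, 'c, 'o) snapshot set) kripke) \<Rightarrow> bool" where
  "is_encoding K \<longleftrightarrow>
     (\<exists>n. \<forall>M. K M = copies n M) \<and> (\<forall>M. machine M \<longrightarrow> kripke (K M))"

end

theory Submission
  imports Defs
begin

text \<open>Run two copies of the machine in parallel. On the paths along which the second copy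
  receives the input of the first one, but idles whenever the acting user is in \<open>GH\<close>, the two
  copies reach exactly the pairs of states obtained from a word and from its purge. So
  noninterference says that no such path reaches, along a correctly purged prefix, a position at
  which some user in \<open>GL\<close> observes a difference.\<close>

fun purge_input :: "'u set \<Rightarrow> ('u \<times> 'c) option \<Rightarrow> ('u \<times> 'c) option" where
  "purge_input G None = None"
| "purge_input G (Some (u, c)) = (if u \<in> G then None else Some (u, c))"

definition purged :: "'u set \<Rightarrow> ('u, 'c, 'o) snapshot set" where
  "purged G = {[(a, f), (b, g)] | a b f g. b = purge_input G a}"

text \<open>Like \<open>purged\<close>, this is one atomic proposition, since every set of snapshots
  is a proposition. Both describe a single structure state holding two copies, so one path suffices
  to compare two runs.\<close>

definition indist :: "'u set \<Rightarrow> ('u, 'c, 'o) snapshot set" where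
  "indist G = {[(a, f), (b, g)] | a b f g. restrict f G = restrict g G}"

text \<open>The right argument of \<open>Until\<close> is the conjunction of
  \<open>purged GH\<close> and the negation of \<open>indist GL\<close>, written with the available
  connectives. \<open>purged GH\<close> recurs there because the left argument constrains only
  strictly earlier positions.\<close>

definition NI_formula :: "'u set \<Rightarrow> 'u set \<Rightarrow> ('u, 'c, 'o) snapshot set hyperctl" where
  "NI_formula GH GL =
     Neg (Ex_path (Until (Atom (purged GH) 0)
       (Neg (Disj (Neg (Atom (purged GH) 0)) (Atom (indist GL) 0)))))"

text \<open>A state stores the input that led to it, so letter \<open>i - 1\<close> appears at
  position \<open>i\<close>. Paths are infinite, so the copies idle once the word is
  exhausted.\<close>

definition word_input :: "'a list \<Rightarrow> nat \<Rightarrow> 'a option" where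
  "word_input w i = (if 0 < i \<and> i \<le> length w then Some (w ! (i - 1)) else None)"

definition word_path ::
    "('s, 'u, 'c, 'o) machine \<Rightarrow> 'u set \<Rightarrow> ('u \<times> 'c) list \<Rightarrow> nat \<Rightarrow> ('s, 'u, 'c) config" where
  "word_path M G w i =
     [(run M (minit M) (take i w), word_input w i),
      (run M (minit M) (purge G (take i w)), purge_input G (word_input w i))]"

lemma run_append: "run M s (v @ w) = run M (run M s v) w"
  by (induction M s v rule: run.induct) auto

lemma run_in_mstates:
  assumes "machine M" "s \<in> mstates M" "w \<in> lists (users M \<times> commands M)"
  shows "run M s w \<in> mstates M"
  using assms(2,3)
proof (induction w arbitrary: s)
  case (Cons x w)
  then show ?case
    using assms(1) by (cases x) (auto simp: machine_def)
qed auto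

lemma purge_append: "purge G (v @ w) = purge G v @ purge G w"
  by (simp add: purge_def)

lemma purge_in_lists: "w \<in> lists A \<Longrightarrow> purge G w \<in> lists A"
  by (auto simp: purge_def)

lemma take_in_lists: "w \<in> lists A \<Longrightarrow> take i w \<in> lists A"
  by (auto dest: in_set_takeD)

lemma kripke_copies:
  assumes "machine M"
  shows "kripke (copies n M)"
proof -
  let ?A = "mstates M \<times> insert None (Some ` (users M \<times> commands M))"
  have init: "kinit (copies n M) \<in> kstates (copies n M)"
    using assms by (auto simp: copies_def machine_def)
  have moves: "moves M (fst sa) \<subseteq> ?A" if "sa \<in> ?A" for sa
    using that assms by (auto simp: moves_def machine_def)
  have "succs (copies n M) x \<subseteq> kstates (copies n M)" if x: "x \<in> kstates (copies n M)" for x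
  proof
    fix y
    assume "y \<in> succs (copies n M) x"
    then have y: "list_all2 (\<lambda>sa tb. tb \<in> moves M (fst sa)) x y"
      by (simp add: copies_def)
    have "set y \<subseteq> ?A"
    proof
      fix tb
      assume "tb \<in> set y"
      then obtain i where "i < length y" "tb = y ! i"
        by (auto simp: in_set_conv_nth)
      with y have "tb \<in> moves M (fst (x ! i))" "x ! i \<in> set x"
        by (auto simp: list_all2_conv_all_nth)
      then show "tb \<in> ?A"
        using moves[of "x ! i"] x by (auto simp: copies_def)
    qed
    with x y show "y \<in> kstates (copies n M)"
      by (auto simp: copies_def dest: list_all2_lengthD)
  qed
  moreover have "succs (copies n M) x \<noteq> {}" for x
  proof -
    \<comment> \<open>All copies may idle at once, so a successor exists even without users or
      commands.\<close>
    have "map (\<lambda>sa. (fst sa, None)) x \<in> succs (copies n M) x"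
      by (auto simp: copies_def moves_def list_all2_conv_all_nth)
    then show ?thesis
      by blast
  qed
  moreover have "props (copies n M) = UNIV"
    by (simp add: copies_def)
  ultimately show ?thesis
    using init by (simp add: kripke_def)
qed

lemma sat_NI_formula:
  "models (copies n M) (NI_formula GH GL) \<longleftrightarrow>
     (\<forall>p i. is_path (copies n M) p \<and> p 0 = replicate n (minit M, None) \<and>
        (\<forall>j\<le>i. snapshot M (p j) \<in> purged GH) \<longrightarrow> snapshot M (p i) \<in> indist GL)"
proof -
  have [simp]: "kinit (copies n M) = replicate n (minit M, None)"
    "P \<in> label (copies n M) x \<longleftrightarrow> snapshot M x \<in> P" for P x
    by (simp_all add: copies_def)
  \<comment> \<open>Joins the position where \<open>Until\<close> is fulfilled to the strictly
    earlier ones.\<close>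
  have le: "(\<forall>j\<le>i. R j) \<longleftrightarrow> R i \<and> (\<forall>j<i. R j)" for R and i :: nat
    by (auto simp: le_less)
  show ?thesis
    unfolding le by (simp add: models_def NI_formula_def shift_def) meson
qed

lemma snapshot_in_purged_iff:
  "snapshot M [(s, a), (t, b)] \<in> purged G \<longleftrightarrow> b = purge_input G a"
  by (auto simp: snapshot_def purged_def)

text \<open>Snapshots record observations of \<open>users M\<close> only; restricting further to
  \<open>G\<close> recovers the true observations because \<open>G\<close> lies inside that
  set.\<close>

lemma snapshot_in_indist_iff:
  assumes "G \<subseteq> users M"
  shows "snapshot M [(s, a), (t, b)] \<in> indist G \<longleftrightarrow>
    restrict (out M s) G = restrict (out M t) G"
  using assms by (auto simp: snapshot_def indist_def Int_absorb1)

text \<open>The word collects the inputs of the first copy in order. Idle steps contribute no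
  letter, so it may be shorter than \<open>i\<close>.\<close>

lemma purged_path_reaches:
  assumes p: "is_path (copies 2 M) p" "p 0 = replicate 2 (minit M, None)"
    and "\<forall>j\<le>i. snapshot M (p j) \<in> purged G"
  shows "\<exists>w \<in> lists (users M \<times> commands M). \<exists>a b.
    p i = [(run M (minit M) w, a), (run M (minit M) (purge G w), b)]"
  using assms(3)
proof (induction i)
  case 0
  then show ?case
    using p(2) by (intro bexI[of _ "[]"]) (auto simp: purge_def numeral_2_eq_2)
next
  case (Suc i)
  then obtain w a b where w: "w \<in> lists (users M \<times> commands M)"
    and pi: "p i = [(run M (minit M) w, a), (run M (minit M) (purge G w), b)]"
    by auto
  have "p (Suc i) \<in> succs (copies 2 M) (p i)"
    using p(1) by (simp add: is_path_def)
  then obtain s a' t b' where q: "p (Suc i) = [(s, a'), (t, b')]"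
    and s: "(s, a') \<in> moves M (run M (minit M) w)"
    and t: "(t, b') \<in> moves M (run M (minit M) (purge G w))"
    unfolding pi by (auto simp: copies_def list_all2_Cons1)
  \<comment> \<open>Correct purging at the new position determines the input of the second
    copy.\<close>
  have b': "b' = purge_input G a'"
    using Suc.prems q by (metis le_refl snapshot_in_purged_iff)
  show ?case
  proof (cases a')
    \<comment> \<open>Both copies idle, so the old word still serves.\<close>
    case None
    then show ?thesis
      using w s t b' unfolding q by (intro bexI[of _ w]) (auto simp: moves_def)
  next
    case (Some x)
    then obtain u c where x: "a' = Some (u, c)"
      by (cases x) auto
    \<comment> \<open>If \<open>u\<close> is in \<open>G\<close>, the second copy idles and the
      purge drops the new letter; otherwise both copies execute it.\<close>
    then show ?thesis
      using w s t b' unfolding q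
      by (intro bexI[of _ "w @ [(u, c)]"])
        (auto simp: moves_def run_append purge_append purge_def split: if_splits)
  qed
qed

lemma word_input_in:
  assumes "w \<in> lists A"
  shows "word_input w i \<in> insert None (Some ` A)"
  using assms by (auto simp: word_input_def in_lists_conv_set)

lemma purge_input_in:
  assumes "a \<in> insert None (Some ` A)"
  shows "purge_input G a \<in> insert None (Some ` A)"
  using assms by (cases "(G, a)" rule: purge_input.cases) auto

text \<open>This supplies the converse of \<open>purged_path_reaches\<close>: every word and its
  purge are executed side by side along some path.\<close>

lemma word_path_is_path:
  assumes M: "machine M" and w: "w \<in> lists (users M \<times> commands M)"
  shows "is_path (copies 2 M) (word_path M G w)"
  unfolding is_path_def
proof (intro allI conjI)
  fix i
  have init: "minit M \<in> mstates M"
    using M by (simp add: machine_def)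
  show "word_path M G w i \<in> kstates (copies 2 M)"
    using run_in_mstates[OF M init] take_in_lists[OF w] purge_in_lists[OF take_in_lists[OF w]]
      word_input_in[OF w] purge_input_in[OF word_input_in[OF w]]
    by (simp add: copies_def word_path_def del: insert_iff)
  show "word_path M G w (Suc i) \<in> succs (copies 2 M) (word_path M G w i)"
  proof (cases "i < length w")
    case True
    obtain u c where x: "w ! i = (u, c)"
      by (cases "w ! i")
    have "(u, c) \<in> users M \<times> commands M"
      using True w x by (metis in_lists_conv_set nth_mem)
    with True x show ?thesis
      by (auto simp: copies_def word_path_def word_input_def moves_def take_Suc_conv_app_nth
          run_append purge_append purge_def)
  next
    \<comment> \<open>Past the end of the word, \<open>take\<close> no longer changes and both
      inputs are \<open>None\<close>.\<close>
    case False
    then show ?thesis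
      by (auto simp: copies_def word_path_def word_input_def moves_def)
  qed
qed

lemma not_interferes_iff_models:
  assumes M: "machine M" and GL: "GL \<subseteq> users M"
  shows "not_interferes M GH GL \<longleftrightarrow> models (copies 2 M) (NI_formula GH GL)"
proof
  assume NI: "not_interferes M GH GL"
  show "models (copies 2 M) (NI_formula GH GL)"
    unfolding sat_NI_formula
  proof (intro allI impI, elim conjE)
    fix p i
    assume "is_path (copies 2 M) p" "p 0 = replicate 2 (minit M, None)"
      "\<forall>j\<le>i. snapshot M (p j) \<in> purged GH"
    from purged_path_reaches[OF this]
    obtain w a b where "w \<in> lists (users M \<times> commands M)"
      and "p i = [(run M (minit M) w, a), (run M (minit M) (purge GH w), b)]"
      by blast
    with NI show "snapshot M (p i) \<in> indist GL"
      by (simp add: snapshot_in_indist_iff[OF GL] not_interferes_def outs_def)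
  qed
next
  assume models: "models (copies 2 M) (NI_formula GH GL)"
  show "not_interferes M GH GL"
    unfolding not_interferes_def
  proof
    fix w
    assume w: "w \<in> lists (users M \<times> commands M)"
    have "word_path M GH w 0 = replicate 2 (minit M, None)"
      by (simp add: word_path_def word_input_def purge_def numeral_2_eq_2)
    moreover have "snapshot M (word_path M GH w j) \<in> purged GH" for j
      by (simp add: word_path_def snapshot_in_purged_iff)
    \<comment> \<open>At position \<open>length w\<close> the first copy has read all of
      \<open>w\<close> and the second all of its purge.\<close>
    ultimately have "snapshot M (word_path M GH w (length w)) \<in> indist GL"
      using models word_path_is_path[OF M w] unfolding sat_NI_formula by blast
    then show "outs M w GL = outs M (purge GH w) GL"
      by (simp add: word_path_def snapshot_in_indist_iff[OF GL] outs_def)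
  qed
qed

theorem theorem10:
  shows "\<exists>(\<phi>_NI :: 'u set \<Rightarrow> 'u set \<Rightarrow> ('u, 'c, 'o) snapshot set hyperctl)
      (K :: ('s, 'u, 'c, 'o) machine \<Rightarrow>
        (('s, 'u, 'c) config, ('u, 'c, 'o) snapshot set) kripke).
    is_encoding K \<and>
    (\<forall>M GH GL. machine M \<and> GH \<subseteq> users M \<and> GL \<subseteq> users M \<longrightarrow>
      formula_over (props (K M)) 0 (\<phi>_NI GH GL) \<and>
      (not_interferes M GH GL \<longleftrightarrow> models (K M) (\<phi>_NI GH GL)))"
proof (rule exI[of _ NI_formula], rule exI[of _ "copies 2"], intro conjI allI impI)
  show "is_encoding (copies 2 :: ('s, 'u, 'c, 'o) machine \<Rightarrow> _)"
    using kripke_copies by (auto simp: is_encoding_def)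
next
  fix M :: "('s, 'u, 'c, 'o) machine" and GH GL :: "'u set"
  show "formula_over (props (copies 2 M)) 0 (NI_formula GH GL)"
    by (simp add: NI_formula_def copies_def)
next
  fix M :: "('s, 'u, 'c, 'o) machine" and GH GL :: "'u set"
  assume "machine M \<and> GH \<subseteq> users M \<and> GL \<subseteq> users M"
  then show "not_interferes M GH GL \<longleftrightarrow> models (copies 2 M) (NI_formula GH GL)"
    by (simp add: not_interferes_iff_models)
qed

end
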